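(* Let $n\ge4$. The admissible subalgebras of $K(\mathbf{DP}_n)$ are exactly the algebras $\mathbf K_n^U$, for $U$ ranging over the up-sets of $X_n$. Moreover, for up-sets $U,W$ of $X_n$, $K_n^U\subset K_n^W$ if and only if $U\subset W$.
   Context: For a bounded commutative residuated lattice $\mathbf A$ (lattice, commutative monoid $(A,\cdot,1)$ with $ab\le c$ iff $a\le b\to c$, $1$ greatest, $0$ least), $K(\mathbf A)$ is the algebra on $A\times A$ with $(a,b)\vee(c,d)=(a\vee c,b\wedge d)$, $(a,b)\wedge(c,d)=(a\wedge c,b\vee d)$, $(a,b)(c,d)=(ac,(a\to d)\wedge(c\to b))$, $(a,b)\to(c,d)=((a\to c)\wedge(d\to b),ad)$, unit $(1,1)$ and constant $0$ as $(0,1)$. A subalgebra $\mathbf S$ of $K(\mathbf A)$ is admissible if $\{s\in S: s\le (1,1)\}=\{(a,1):a\in A\}$ (i.e. its negative cone equals that of $K(\mathbf A)$). The drastic product chain $\mathbf{DP}_n$ has universe $\{0=a_{n-1}<a_{n-2}<\dots<a_1<1\}$, product $xy=0$ if $x,y\ne1$ and $xy=x\wedge y$ otherwise, and implication $x\to y=1$ if $x\le y$, $x\to y=a_1$ if $1>x>y$, $1\to y=y$. Let $K_n^\emptyset=\{(x,1),(1,x),(x,a_1),(a_1,x):x\in DP_n\}$. Let $X_n=\{(a_i,a_j):i\ge j>1\}$, ordered coordinatewise (as a subset of $DP_n\times DP_n$). For an up-set $U$ of $X_n$, $K_n^U=K_n^\emptyset\cup\{(x,y):(x,y)\in U\text{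 or }(y,x)\in U\}$ and $\mathbf K_n^U$ is the corresponding subalgebra of $K(\mathbf{DP}_n)$. *)

theory Defs
  imports "HOL-Algebra.Group"
begin

record 'a res_lattice = "'a monoid" +
  rl_join :: "'a \<Rightarrow> 'a \<Rightarrow> 'a"
  rl_meet :: "'a \<Rightarrow> 'a \<Rightarrow> 'a"
  rl_imp  :: "'a \<Rightarrow> 'a \<Rightarrow> 'a"
  rl_zero :: "'a"

definition rl_le :: "('a, 'm) res_lattice_scheme \<Rightarrow> 'a \<Rightarrow> 'a \<Rightarrow> bool" where
  "rl_le A x y \<longleftrightarrow> rl_meet A x y = x"

locale bounded_comm_res_lattice = comm_monoid A for A (structure) +
  assumes join_closed: "\<lbrakk>x \<in> carrier A; y \<in> carrier A\<rbrakk> \<Longrightarrow> rl_join A x y \<in> carrier A"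
    and meet_closed: "\<lbrakk>x \<in> carrier A; y \<in> carrier A\<rbrakk> \<Longrightarrow> rl_meet A x y \<in> carrier A"
    and imp_closed: "\<lbrakk>x \<in> carrier A; y \<in> carrier A\<rbrakk> \<Longrightarrow> rl_imp A x y \<in> carrier A"
    and zero_closed: "rl_zero A \<in> carrier A"
    and join_comm: "\<lbrakk>x \<in> carrier A; y \<in> carrier A\<rbrakk> \<Longrightarrow> rl_join A x y = rl_join A y x"
    and meet_comm: "\<lbrakk>x \<in> carrier A; y \<in> carrier A\<rbrakk> \<Longrightarrow> rl_meet A x y = rl_meet A y x"
    and join_assoc: "\<lbrakk>x \<in> carrier A; y \<in> carrier A; z \<in> carrier A\<rbrakk>
      \<Longrightarrow> rl_join A (rl_join A x y) z = rl_join A x (rl_join A y z)"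
    and meet_assoc: "\<lbrakk>x \<in> carrier A; y \<in> carrier A; z \<in> carrier A\<rbrakk>
      \<Longrightarrow> rl_meet A (rl_meet A x y) z = rl_meet A x (rl_meet A y z)"
    and join_absorb: "\<lbrakk>x \<in> carrier A; y \<in> carrier A\<rbrakk> \<Longrightarrow> rl_join A x (rl_meet A x y) = x"
    and meet_absorb: "\<lbrakk>x \<in> carrier A; y \<in> carrier A\<rbrakk> \<Longrightarrow> rl_meet A x (rl_join A x y) = x"
    and residuation: "\<lbrakk>x \<in> carrier A; y \<in> carrier A; z \<in> carrier A\<rbrakk>
      \<Longrightarrow> rl_le A (x \<otimes> y) z \<longleftrightarrow> rl_le A x (rl_imp A y z)"
    and one_greatest: "x \<in> carrier A \<Longrightarrow> rl_le A x \<one>"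
    and zero_least: "x \<in> carrier A \<Longrightarrow> rl_le A (rl_zero A) x"

text \<open>The constant \<open>rl_zero\<close> of the algebra below is not the least element of its lattice
  order, and its unit is not the greatest one.\<close>

definition K_alg :: "('a, 'm) res_lattice_scheme \<Rightarrow> ('a \<times> 'a) res_lattice" where
  "K_alg A =
    \<lparr> carrier = carrier A \<times> carrier A,
      monoid.mult = (\<lambda>(a, b) (c, d). (a \<otimes>\<^bsub>A\<^esub> c, rl_meet A (rl_imp A a d) (rl_imp A c b))),
      one = (\<one>\<^bsub>A\<^esub>, \<one>\<^bsub>A\<^esub>),
      rl_join = (\<lambda>(a, b) (c, d). (rl_join A a c, rl_meet A b d)),
      rl_meet = (\<lambda>(a, b) (c, d). (rl_meet A a c, rl_join A b d)),
      rl_imp = (\<lambda>(a, b) (c, d). (rl_meet A (rl_imp A a c) (rl_imp A d b), a \<otimes>\<^bsub>A\<^esub> d)),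
      rl_zero = (rl_zero A, \<one>\<^bsub>A\<^esub>) \<rparr>"

text \<open>Subalgebras are given by their universes, as for \<^const>\<open>subgroup\<close>.\<close>

definition rl_subalgebra :: "'a set \<Rightarrow> ('a, 'm) res_lattice_scheme \<Rightarrow> bool" where
  "rl_subalgebra S B \<longleftrightarrow>
     S \<subseteq> carrier B \<and> \<one>\<^bsub>B\<^esub> \<in> S \<and> rl_zero B \<in> S \<and>
     (\<forall>s\<in>S. \<forall>t\<in>S. rl_join B s t \<in> S \<and> rl_meet B s t \<in> S \<and>
                   s \<otimes>\<^bsub>B\<^esub> t \<in> S \<and> rl_imp B s t \<in> S)"

definition admissible :: "('a \<times> 'a) set \<Rightarrow> ('a, 'm) res_lattice_scheme \<Rightarrow> bool" where
  "admissible S A \<longleftrightarrow>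
     rl_subalgebra S (K_alg A) \<and>
     {s \<in> S. rl_le (K_alg A) s (\<one>\<^bsub>A\<^esub>, \<one>\<^bsub>A\<^esub>)} = {(a, \<one>\<^bsub>A\<^esub>) | a. a \<in> carrier A}"

text \<open>The drastic product chain is realised on \<open>{0, \<dots>, n - 1}\<close> with the usual order:
  the top element \<open>1\<close> of the chain is the number \<open>n - 1\<close>, and \<open>a\<^sub>i\<close>
  is the number \<open>n - 1 - i\<close> for \<open>1 \<le> i \<le> n - 1\<close>, so that \<open>a\<^sub>n\<^sub>-\<^sub>1\<close> is \<open>0\<close>.\<close>

definition dp_top :: "nat \<Rightarrow> nat" where
  "dp_top n = n - 1"

definition dp_a :: "nat \<Rightarrow> nat \<Rightarrow> nat" where
  "dp_a n i = n - 1 - i"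

definition DP :: "nat \<Rightarrow> nat res_lattice" where
  "DP n =
    \<lparr> carrier = {0..<n},
      monoid.mult = (\<lambda>x y. if x \<noteq> dp_top n \<and> y \<noteq> dp_top n then 0 else min x y),
      one = dp_top n,
      rl_join = max,
      rl_meet = min,
      rl_imp = (\<lambda>x y. if x \<le> y then dp_top n else if x < dp_top n then dp_a n 1 else y),
      rl_zero = 0 \<rparr>"

definition X_set :: "nat \<Rightarrow> (nat \<times> nat) set" where
  "X_set n = {(dp_a n i, dp_a n j) | i j. 1 < j \<and> j \<le> i \<and> i \<le> n - 1}"

definition pair_le :: "nat \<Rightarrow> nat \<times> nat \<Rightarrow> nat \<times> nat \<Rightarrow> bool" where
  "pair_le n p q \<longleftrightarrow> rl_le (DP n) (fst p) (fst q) \<and> rl_le (DP n) (snd p) (snd q)"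

definition upset_of :: "'a set \<Rightarrow> ('a \<Rightarrow> 'a \<Rightarrow> bool) \<Rightarrow> 'a set \<Rightarrow> bool" where
  "upset_of X r U \<longleftrightarrow> U \<subseteq> X \<and> (\<forall>p\<in>U. \<forall>q\<in>X. r p q \<longrightarrow> q \<in> U)"

definition K_empty :: "nat \<Rightarrow> (nat \<times> nat) set" where
  "K_empty n = (\<Union>x\<in>carrier (DP n).
     {(x, \<one>\<^bsub>DP n\<^esub>), (\<one>\<^bsub>DP n\<^esub>, x), (x, dp_a n 1), (dp_a n 1, x)})"

definition K_up :: "nat \<Rightarrow> (nat \<times> nat) set \<Rightarrow> (nat \<times> nat) set" where
  "K_up n U = K_empty n \<union> {(x, y). (x, y) \<in> U \<or> (y, x) \<in> U}"

lemma rl_le_DP [simp]: "rl_le (DP n) x y \<longleftrightarrow> x \<le> y"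
  by (auto simp: rl_le_def DP_def)

lemma bounded_comm_res_lattice_DP:
  assumes "n \<ge> 2"
  shows "bounded_comm_res_lattice (DP n)"
proof -
  have "comm_monoid (DP n)"
    by (rule comm_monoidI) (use assms in \<open>auto simp: DP_def dp_top_def min_def\<close>)
  then show ?thesis
    unfolding bounded_comm_res_lattice_def bounded_comm_res_lattice_axioms_def rl_le_DP
    using assms
    by (auto simp: DP_def dp_top_def dp_a_def min_def max_def)
qed

lemma rl_le_K_DP:
  "rl_le (K_alg (DP n)) (a, b) (c, d) \<longleftrightarrow> a \<le> c \<and> d \<le> b"
  by (auto simp: rl_le_def K_alg_def DP_def)

end

theory Submission
  imports Defs
begin

text \<open>The map \<open>s \<mapsto> (s \<rightarrow> (1, 1))\<close> swaps the two coordinates, so an admissible subalgebra is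
  determined by its pairs \<open>(x, y)\<close> with \<open>x \<le> y\<close>. It contains all \<open>(x, 1)\<close>, and from these the
  operations generate \<open>K\<^sub>n\<^sup>\<emptyset>\<close>; what is left lies in \<open>X\<^sub>n\<close> up to a swap. Joining with \<open>(z, 1)\<close>
  raises the first coordinate arbitrarily, and with the swap also the second, which gives
  the up-set condition. Conversely, residuals with an antecedent other than \<open>1\<close> take only the values
  \<open>1\<close> and \<open>a\<^sub>1\<close>, so products and residuals never leave \<open>K\<^sub>n\<^sup>U\<close>.\<close>

text \<open>The coding of \<open>a\<^sub>i\<close> by \<open>n - 1 - i\<close> reverses indices:
  \<open>i \<ge> j\<close> turns into \<open>x \<le> y\<close>, and \<open>j > 1\<close> says that
  \<open>y\<close> lies strictly below \<open>a\<^sub>1\<close>, the number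
  \<open>n - 2\<close>.\<close>

lemma X_set_iff:
  assumes "n \<ge> 4"
  shows "(x, y) \<in> X_set n \<longleftrightarrow> x \<le> y \<and> y + 3 \<le> n"
proof
  assume "(x, y) \<in> X_set n"
  then show "x \<le> y \<and> y + 3 \<le> n"
    using assms by (auto simp: X_set_def dp_a_def)
next
  assume "x \<le> y \<and> y + 3 \<le> n"
  then have "x = dp_a n (n - 1 - x)" "y = dp_a n (n - 1 - y)"
    "1 < n - 1 - y" "n - 1 - y \<le> n - 1 - x" "n - 1 - x \<le> n - 1"
    by (auto simp: dp_a_def)
  then show "(x, y) \<in> X_set n"
    unfolding X_set_def by blast
qed

lemma mem_K_empty_iff:
  assumes "n \<ge> 4"
  shows "(x, y) \<in> K_empty n \<longleftrightarrow> x < n \<and> y < n \<and> (n - 2 \<le> x \<or> n - 2 \<le> y)"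
proof -
  have high: "n - 2 \<le> z \<longleftrightarrow> z = n - 1 \<or> z = n - 2" if "z < n" for z
    using that by auto
  have "n - 1 < n" "n - 2 < n" "dp_a n 1 = n - 2"
    using assms by (auto simp: dp_a_def)
  then show ?thesis
    using high[of x] high[of y] by (auto simp: K_empty_def DP_def dp_top_def)
qed

text \<open>Pairs in \<open>X_set n\<close> are sorted, so of \<open>(x, y)\<close> and
  \<open>(y, x)\<close> only the sorted one has to be tested against \<open>U\<close>.\<close>

lemma mem_K_up_iff:
  assumes "n \<ge> 4" and "U \<subseteq> X_set n"
  shows "(x, y) \<in> K_up n U \<longleftrightarrow>
    x < n \<and> y < n \<and> (n - 2 \<le> x \<or> n - 2 \<le> y \<or> (min x y, max x y) \<in> U)"
proof -
  have U: "x \<le> y" "y + 3 \<le> n" if "(x, y) \<in> U" for x y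
    using that assms X_set_iff by blast+
  show ?thesis
    unfolding K_up_def Un_iff mem_K_empty_iff[OF assms(1)]
    using U[of x y] U[of y x] by (cases "x \<le> y") (auto simp: min_def max_def)
qed

lemma K_DP_simps:
  shows "carrier (K_alg (DP n)) = {0..<n} \<times> {0..<n}"
    and "\<one>\<^bsub>K_alg (DP n)\<^esub> = (n - 1, n - 1)"
    and "rl_zero (K_alg (DP n)) = (0, n - 1)"
    and "rl_join (K_alg (DP n)) (a, b) (c, d) = (max a c, min b d)"
    and "rl_meet (K_alg (DP n)) (a, b) (c, d) = (min a c, max b d)"
    and "(a, b) \<otimes>\<^bsub>K_alg (DP n)\<^esub> (c, d) =
      (a \<otimes>\<^bsub>DP n\<^esub> c, min (rl_imp (DP n) a d) (rl_imp (DP n) c b))"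
    and "rl_imp (K_alg (DP n)) (a, b) (c, d) =
      (min (rl_imp (DP n) a c) (rl_imp (DP n) d b), a \<otimes>\<^bsub>DP n\<^esub> d)"
  by (simp_all add: K_alg_def DP_def dp_top_def)

lemma DP_ops:
  shows "x \<otimes>\<^bsub>DP n\<^esub> y = (if x \<noteq> n - 1 \<and> y \<noteq> n - 1 then 0 else min x y)"
    and "rl_imp (DP n) x y = (if x \<le> y then n - 1 else if x < n - 1 then n - 2 else y)"
  by (simp_all add: DP_def dp_top_def dp_a_def numeral_2_eq_2)

text \<open>A pair of \<open>K_alg (DP n)\<close> lies below the unit iff its second coordinate is
  the top \<open>n - 1\<close>, so one inclusion between the two cones is automatic.\<close>

lemma admissible_iff:
  "admissible S (DP n) \<longleftrightarrow> rl_subalgebra S (K_alg (DP n)) \<and> (\<forall>a<n. (a, n - 1) \<in> S)"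
proof -
  have "S \<subseteq> {0..<n} \<times> {0..<n} \<Longrightarrow>
    {s \<in> S. rl_le (K_alg (DP n)) s (n - 1, n - 1)} = {(a, n - 1) | a. a < n} \<longleftrightarrow>
    (\<forall>a<n. (a, n - 1) \<in> S)"
    by (fastforce simp: rl_le_K_DP)
  moreover have "\<one>\<^bsub>DP n\<^esub> = n - 1" "carrier (DP n) = {0..<n}"
    by (simp_all add: DP_def dp_top_def)
  ultimately show ?thesis
    unfolding admissible_def rl_subalgebra_def K_DP_simps by auto
qed

lemma admissible_K_up:
  assumes n: "n \<ge> 4" and U: "upset_of (X_set n) (pair_le n) U"
  shows "admissible (K_up n U) (DP n)"
proof -
  have sub: "U \<subseteq> X_set n"
    using U by (simp add: upset_of_def)
  note mem = mem_K_up_iff[OF n sub]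
  have swap: "(y, x) \<in> K_up n U" if "(x, y) \<in> K_up n U" for x y
    using that by (auto simp: mem min.commute max.commute)
  have up: "(x', y') \<in> K_up n U"
    if "(x, y) \<in> K_up n U" "x \<le> x'" "y \<le> y'" "x' < n" "y' < n" for x y x' y'
  proof (cases "n - 2 \<le> x' \<or> n - 2 \<le> y'")
    case True
    then show ?thesis using that by (auto simp: mem)
  next
    case False
    then have "(min x y, max x y) \<in> U"
      using that by (auto simp: mem)
    moreover have "(min x' y', max x' y') \<in> X_set n"
      using False n by (auto simp: X_set_iff)
    \<comment> \<open>Sorting is monotone, since \<open>min\<close> and \<open>max\<close>
      are.\<close>
    moreover have "pair_le n (min x y, max x y) (min x' y', max x' y')"
      using that by (auto simp: pair_le_def)
    ultimately have "(min x' y', max x' y') \<in> U"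
      using U unfolding upset_of_def by blast
    then show ?thesis using that by (simp add: mem)
  qed
  \<comment> \<open>The value \<open>min a c\<close> is \<open>a\<close> or \<open>c\<close>; the
    pair it comes from only has its second coordinate raised.\<close>
  have meet: "(min a c, max b d) \<in> K_up n U"
    if "(a, b) \<in> K_up n U" "(c, d) \<in> K_up n U" for a b c d
  proof -
    have "a < n" "b < n" "c < n" "d < n"
      using that by (auto simp: mem)
    then show ?thesis
      using up[OF that(1), of a "max b d"] up[OF that(2), of c "max b d"]
      by (auto simp: min_def)
  qed
  \<comment> \<open>The swap interchanges meet and join.\<close>
  have join: "(max a c, min b d) \<in> K_up n U"
    if "(a, b) \<in> K_up n U" "(c, d) \<in> K_up n U" for a b c d
    using swap[OF meet[OF swap[OF that(1)] swap[OF that(2)]]] .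
  have mult: "(a \<otimes>\<^bsub>DP n\<^esub> c, min (rl_imp (DP n) a d) (rl_imp (DP n) c b)) \<in> K_up n U"
    if "(a, b) \<in> K_up n U" "(c, d) \<in> K_up n U" for a b c d
  proof -
    have lt: "a < n" "b < n" "c < n" "d < n"
      using that by (auto simp: mem)
    have high: "(x, y) \<in> K_up n U" if "x < n" "y = n - 1 \<or> y = n - 2" for x y
      using that n by (auto simp: mem)
    consider "a = n - 1" "c = n - 1" | "a = n - 1" "c \<noteq> n - 1" | "a \<noteq> n - 1" "c = n - 1"
      | "a \<noteq> n - 1" "c \<noteq> n - 1" by blast
    then show ?thesis
    proof cases
      case 1
      then show ?thesis using lt n by (auto simp: DP_ops mem)
    next
      \<comment> \<open>Here the product is \<open>(c, d)\<close> itself if \<open>d\<close> is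
        below the top; otherwise its second coordinate is \<open>1\<close> or
        \<open>a\<^sub>1\<close>. The next case is symmetric.\<close>
      case 2
      then show ?thesis
        using lt that by (cases "d = n - 1") (auto simp: DP_ops min_def intro!: high)
    next
      case 3
      then show ?thesis
        using lt that by (cases "b = n - 1") (auto simp: DP_ops min_def intro!: high)
    next
      case 4
      then show ?thesis using lt by (auto simp: DP_ops min_def intro!: high)
    qed
  qed
  \<comment> \<open>With \<open>'\<close> denoting the swap,
    \<open>s \<rightarrow> t = (s t')'\<close>.\<close>
  have imp: "(min (rl_imp (DP n) a c) (rl_imp (DP n) d b), a \<otimes>\<^bsub>DP n\<^esub> d) \<in> K_up n U"
    if "(a, b) \<in> K_up n U" "(c, d) \<in> K_up n U" for a b c d
    using swap[OF mult[OF that(1) swap[OF that(2)]]] .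
  have carr: "K_up n U \<subseteq> {0..<n} \<times> {0..<n}"
    by (auto simp: mem)
  have cone: "(a, n - 1) \<in> K_up n U" if "a < n" for a
    using that n by (auto simp: mem)
  have "rl_subalgebra (K_up n U) (K_alg (DP n))"
    unfolding rl_subalgebra_def
    using n carr cone[of 0] cone[of "n - 1"] by (auto simp: K_DP_simps meet join mult imp)
  then show ?thesis
    using cone by (simp add: admissible_iff)
qed

lemma admissible_swap:
  assumes "admissible S (DP n)" and "(x, y) \<in> S"
  shows "(y, x) \<in> S"
proof -
  have S: "rl_subalgebra S (K_alg (DP n))"
    using assms(1) by (simp add: admissible_iff)
  then have "rl_imp (K_alg (DP n)) (x, y) \<one>\<^bsub>K_alg (DP n)\<^esub> \<in> S" "x < n" "y < n"
    using assms(2) by (auto simp: rl_subalgebra_def K_DP_simps(1))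
  then show ?thesis
    by (cases "y = n - 1") (auto simp: K_DP_simps DP_ops min_def split: if_splits)
qed

lemma admissible_up:
  assumes S: "admissible S (DP n)" and "(x, y) \<in> S"
    and "x \<le> x'" "y \<le> y'" "x' < n" "y' < n"
  shows "(x', y') \<in> S"
proof -
  have raise: "(u', v) \<in> S" if "(u, v) \<in> S" "u \<le> u'" "u' < n" for u u' v
  proof -
    have "rl_join (K_alg (DP n)) (u, v) (u', n - 1) \<in> S" "v < n"
      using S that by (auto simp: admissible_iff rl_subalgebra_def K_DP_simps(1))
    then show ?thesis
      using that by (simp add: K_DP_simps)
  qed
  have "(x', y) \<in> S"
    using raise assms by blast
  then show ?thesis
    using raise admissible_swap[OF S] assms by blast
qed

text \<open>Up to a swap, every pair of \<open>K_empty n\<close> lies above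
  \<open>(a\<^sub>1, 0)\<close>, so it suffices to produce that pair.\<close>

lemma K_empty_subset_admissible:
  assumes n: "n \<ge> 4" and S: "admissible S (DP n)"
  shows "K_empty n \<subseteq> S"
proof -
  have sub: "rl_subalgebra S (K_alg (DP n))" and cone: "\<And>a. a < n \<Longrightarrow> (a, n - 1) \<in> S"
    using S by (auto simp: admissible_iff)
  have imp: "rl_imp (K_alg (DP n)) s t \<in> S" if "s \<in> S" "t \<in> S" for s t
    using sub that by (simp add: rl_subalgebra_def)
  \<comment> \<open>The number \<open>1\<close> is the atom of the chain, not its unit. It lies
    strictly between \<open>0\<close> and \<open>a\<^sub>1\<close>, so its residual to
    \<open>0\<close> is \<open>a\<^sub>1\<close>.\<close>
  have "rl_imp (K_alg (DP n)) (1, n - 1) (0, n - 1) \<in> S"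
    using n by (intro imp cone) auto
  moreover have "Suc 0 < n - Suc 0" "min (n - 2) (n - Suc 0) = n - 2"
    using n by auto
  ultimately have a: "(n - 2, 1) \<in> S"
    by (simp add: K_DP_simps DP_ops)
  then have "(n - 2, n - 2) \<in> S"
    by (rule admissible_up[OF S]) (use n in auto)
  \<comment> \<open>\<open>(a\<^sub>1, 0)\<close> is the one element that needs \<open>n \<ge> 4\<close>: it is
    \<open>(a\<^sub>1, x) \<rightarrow> (a\<^sub>1, a\<^sub>1)\<close> for some \<open>0 < x < a\<^sub>1\<close>.\<close>
  with a have "rl_imp (K_alg (DP n)) (n - 2, 1) (n - 2, n - 2) \<in> S"
    by (rule imp)
  moreover have "\<not> n - 2 \<le> 1" "n - 2 < n - 1"
    using n by auto
  ultimately have b: "(n - 2, 0) \<in> S"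
    by (simp add: K_DP_simps DP_ops)
  have c: "(x, y) \<in> S" if "x < n" "y < n" "n - 2 \<le> x" for x y
    using admissible_up[OF S b] that by simp
  have "(x, y) \<in> S" if "(x, y) \<in> K_empty n" for x y
    using that c admissible_swap[OF S] mem_K_empty_iff[OF n] by blast
  then show ?thesis by auto
qed

lemma admissible_imp_K_up:
  assumes n: "n \<ge> 4" and S: "admissible S (DP n)"
  shows "upset_of (X_set n) (pair_le n) (S \<inter> X_set n)" and "S = K_up n (S \<inter> X_set n)"
proof -
  have "q \<in> S" if "p \<in> S" "q \<in> X_set n" "pair_le n p q" for p q
  proof -
    obtain x y x' y' where pq: "p = (x, y)" "q = (x', y')"
      by (metis surj_pair)
    show ?thesis
      using that n admissible_up[OF S, of x y x' y']
      by (simp add: pq X_set_iff pair_le_def)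
  qed
  then show "upset_of (X_set n) (pair_le n) (S \<inter> X_set n)"
    by (auto simp: upset_of_def)
  have S_iff: "(x, y) \<in> S \<longleftrightarrow> (x, y) \<in> K_up n (S \<inter> X_set n)" for x y
  proof (cases "(x, y) \<in> K_empty n")
    case True
    then show ?thesis
      using K_empty_subset_admissible[OF n S] by (auto simp: K_up_def)
  next
    case False
    have "x < n \<and> y < n" if "(x, y) \<in> S"
      using S that by (auto simp: admissible_iff rl_subalgebra_def K_DP_simps(1))
    \<comment> \<open>Outside \<open>K_empty n\<close> both coordinates are below
      \<open>a\<^sub>1\<close>, and one of the two orders is sorted.\<close>
    then have "(x, y) \<in> X_set n \<or> (y, x) \<in> X_set n" if "(x, y) \<in> S"
      using False n that by (auto simp: mem_K_empty_iff X_set_iff)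
    then show ?thesis
      using False admissible_swap[OF S] by (auto simp: K_up_def)
  qed
  then show "S = K_up n (S \<inter> X_set n)"
    by (simp add: set_eq_iff split_paired_all)
qed

text \<open>Both coordinates of a pair in \<open>X_set n\<close> are below \<open>a\<^sub>1\<close>,
  so it avoids \<open>K_empty n\<close>; being sorted already, it can enter \<open>K_up n W\<close>
  only through \<open>W\<close>.\<close>

lemma K_up_subset_iff:
  assumes n: "n \<ge> 4" and "U \<subseteq> X_set n" "W \<subseteq> X_set n"
  shows "K_up n U \<subseteq> K_up n W \<longleftrightarrow> U \<subseteq> W"
proof
  assume le: "K_up n U \<subseteq> K_up n W"
  have "(x, y) \<in> W" if xy: "(x, y) \<in> U" for x y
  proof -
    have "x \<le> y" "y + 3 \<le> n"
      using xy assms X_set_iff[OF n] by blast+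
    moreover have "(x, y) \<in> K_up n W"
      using le xy by (auto simp: K_up_def)
    ultimately show ?thesis
      using assms by (auto simp: mem_K_up_iff)
  qed
  then show "U \<subseteq> W" by auto
qed (auto simp: K_up_def)

theorem theorem3p6:
  fixes n :: nat
  assumes "n \<ge> 4"
  shows "{S. admissible S (DP n)} = {K_up n U | U. upset_of (X_set n) (pair_le n) U} \<and>
    (\<forall>U W. upset_of (X_set n) (pair_le n) U \<longrightarrow> upset_of (X_set n) (pair_le n) W \<longrightarrow>
       (K_up n U \<subseteq> K_up n W \<longleftrightarrow> U \<subseteq> W))"
proof (intro conjI allI impI)
  show "{S. admissible S (DP n)} = {K_up n U | U. upset_of (X_set n) (pair_le n) U}"
    using admissible_imp_K_up[OF assms] admissible_K_up[OF assms] by blast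
next
  fix U W
  assume "upset_of (X_set n) (pair_le n) U" "upset_of (X_set n) (pair_le n) W"
  then show "K_up n U \<subseteq> K_up n W \<longleftrightarrow> U \<subseteq> W"
    by (intro K_up_subset_iff[OF assms]) (auto simp: upset_of_def)
qed

end
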